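(* Let $\Sigma$ be a finite set, let $p\in\Delta(\Sigma)$ have full support, let $g\in\mathbb{R}^{\Sigma}$ be a non-constant vector, and let $\delta>0$. If $$q^*\in\arg\max_{q\in\Delta(\Sigma)}\ \Big(g\cdot q-\frac1\delta\,\mathrm{KL}(q\|p)\Big),$$ then $q^*\propto p\,e^{\delta g}$, i.e. $q^*_u=\dfrac{p_ue^{\delta g_u}}{\sum_{v\in\Sigma}p_ve^{\delta g_v}}$ for all $u\in\Sigma$.
   Context: $\Delta(\Sigma)$ is the set of probability vectors $q=(q_u)_{u\in\Sigma}$ on the finite set $\Sigma$; full support means $p_u>0$ for all $u$. The dot product is $g\cdot q=\sum_{u\in\Sigma}g_uq_u$. $\mathrm{KL}(q\|p)=\sum_{u\in\Sigma}q_u\log\frac{q_u}{p_u}$ with the convention $0\log 0=0$. *)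

theory Defs
  imports "HOL-Analysis.Analysis"
begin

definition prob_vectors :: "(real ^ 's::finite) set" where
  "prob_vectors = {q. (\<forall>u. 0 \<le> q $ u) \<and> (\<Sum>u\<in>UNIV. q $ u) = 1}"

definition full_support :: "real ^ 's::finite \<Rightarrow> bool" where
  "full_support p \<longleftrightarrow> (\<forall>u. 0 < p $ u)"

text \<open>
  The logarithm is natural. The convention \<open>0 log 0 = 0\<close> holds because the factor
  \<open>q $ u\<close> vanishes. The sum is the Kullback-Leibler divergence only where
  \<open>q $ u \<noteq> 0\<close> implies \<open>p $ u \<noteq> 0\<close>, in particular whenever \<open>p\<close> has full support;
  otherwise the true value would be infinite.
\<close>
definition KL :: "real ^ 's::finite \<Rightarrow> real ^ 's \<Rightarrow> real" where
  "KL q p = (\<Sum>u\<in>UNIV. q $ u * ln (q $ u / p $ u))"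

end

theory Submission
  imports Defs
begin

text \<open>
  Let \<open>r\<close> be the Gibbs vector proportional to \<open>p e\<^sup>\<delta>\<^sup>g\<close> and \<open>Z\<close> its normalizing constant. The objective
  at \<open>q\<close> equals \<open>(ln Z - KL q r) / \<delta>\<close>. As \<open>KL r r = 0\<close>, a maximizer \<open>q\<close> satisfies \<open>KL q r \<le> 0\<close>,
  and Gibbs' inequality with its equality case forces \<open>q = r\<close>.
\<close>

text \<open>This is \<open>ln x \<le> x - 1\<close> at \<open>x = b / a\<close>, multiplied by
  \<open>a\<close> and negated. For \<open>a = 0\<close> the right-hand side vanishes and
  \<open>- b \<le> 0\<close> remains.\<close>

lemma mult_ln_div_ge:
  fixes a b :: real
  assumes "0 \<le> a" "0 < b"
  shows "a - b \<le> a * ln (a / b)"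
proof (cases "a = 0")
  case False
  then have "0 < a" using assms by simp
  then have "a * ln (b / a) \<le> a * (b / a - 1)"
    using assms by (intro mult_left_mono ln_le_minus_one) auto
  then show ?thesis using \<open>0 < a\<close> assms by (simp add: ln_div algebra_simps)
qed (use assms in simp)

text \<open>Equality in \<open>ln x \<le> x - 1\<close> holds only at \<open>x = 1\<close>, here for
  \<open>x = b / a\<close>.\<close>

lemma mult_ln_div_eqD:
  fixes a b :: real
  assumes "0 \<le> a" "0 < b" "a * ln (a / b) = a - b"
  shows "a = b"
proof -
  \<comment> \<open>With \<open>a = 0\<close> the equation would read \<open>0 = - b\<close>,
    against \<open>0 < b\<close>.\<close>
  have "a \<noteq> 0" using assms by auto
  then have "0 < a" using assms by simp
  have "a * ln (b / a) = a * (b / a - 1)"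
    using assms \<open>0 < a\<close> by (simp add: ln_div algebra_simps)
  then have "ln (b / a) = b / a - 1" using \<open>a \<noteq> 0\<close> by simp
  then have "b / a = 1" using assms \<open>0 < a\<close> by (intro ln_eq_minus_one) auto
  then show ?thesis using \<open>a \<noteq> 0\<close> by simp
qed

lemma KL_le_zero_imp_eq:
  assumes q: "q \<in> prob_vectors" and r: "r \<in> prob_vectors" "full_support r"
    and le: "KL q r \<le> 0"
  shows "q = r"
proof -
  \<comment> \<open>Summands of \<open>KL q r\<close> may be negative. The correction
    \<open>q $ u - r $ u\<close> makes each one nonnegative and sums to zero, both vectors having
    total mass 1. A sum that is at most zero then forces every \<open>?d u\<close> to
    vanish.\<close>
  let ?d = "\<lambda>u. q $ u * ln (q $ u / r $ u) - (q $ u - r $ u)"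
  have q0: "0 \<le> q $ u" and r0: "0 < r $ u" for u
    using q r by (auto simp: prob_vectors_def full_support_def)
  have nonneg: "0 \<le> ?d u" for u
    using mult_ln_div_ge[OF q0 r0, of u u] by simp
  have "(\<Sum>u\<in>UNIV. ?d u) = KL q r"
    using q r by (simp add: KL_def sum_subtractf prob_vectors_def)
  then have "(\<Sum>u\<in>UNIV. ?d u) = 0"
    using le sum_nonneg[of UNIV ?d, OF nonneg] by linarith
  then have "?d u = 0" for u
    using nonneg by (simp add: sum_nonneg_eq_0_iff)
  then show ?thesis
    by (auto simp: vec_eq_iff intro!: mult_ln_div_eqD[OF q0 r0])
qed

definition gibbs_sum :: "real ^ 's::finite \<Rightarrow> real ^ 's \<Rightarrow> real \<Rightarrow> real" where
  "gibbs_sum p g \<delta> = (\<Sum>v\<in>UNIV. p $ v * exp (\<delta> * g $ v))"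

definition gibbs :: "real ^ 's::finite \<Rightarrow> real ^ 's \<Rightarrow> real \<Rightarrow> real ^ 's" where
  "gibbs p g \<delta> = (\<chi> u. p $ u * exp (\<delta> * g $ u) / gibbs_sum p g \<delta>)"

lemma gibbs_sum_pos: "full_support p \<Longrightarrow> 0 < gibbs_sum p g \<delta>"
  by (auto simp: gibbs_sum_def full_support_def intro!: sum_pos)

lemma full_support_gibbs: "full_support p \<Longrightarrow> full_support (gibbs p g \<delta>)"
  using gibbs_sum_pos[of p g \<delta>] by (simp add: gibbs_def full_support_def)

lemma gibbs_in_prob_vectors:
  assumes "full_support p"
  shows "gibbs p g \<delta> \<in> prob_vectors"
proof -
  have "(\<Sum>u\<in>UNIV. gibbs p g \<delta> $ u) = 1"
    using gibbs_sum_pos[OF assms, of g \<delta>]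
    by (simp add: gibbs_def gibbs_sum_def flip: sum_divide_distrib)
  then show ?thesis
    using full_support_gibbs[OF assms, of g \<delta>]
    by (simp add: prob_vectors_def full_support_def less_imp_le)
qed

text \<open>The logarithm of the Gibbs weight splits into \<open>ln (p $ u)\<close>, a term linear
  in \<open>g\<close> and a constant, which is averaged over the total mass 1 of \<open>q\<close>.
  Up to that constant, the divergence from the Gibbs vector is thus \<open>- \<delta>\<close> times
  the objective.\<close>

lemma KL_gibbs:
  assumes p: "full_support p" and q: "q \<in> prob_vectors"
  shows "KL q (gibbs p g \<delta>) = KL q p - \<delta> * (g \<bullet> q) + ln (gibbs_sum p g \<delta>)"
proof -
  let ?Z = "gibbs_sum p g \<delta>"
  have Z: "0 < ?Z" by (rule gibbs_sum_pos[OF p])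
  have "q $ u * ln (q $ u / gibbs p g \<delta> $ u)
      = q $ u * ln (q $ u / p $ u) - \<delta> * (g $ u * q $ u) + q $ u * ln ?Z" for u
  \<comment> \<open>The logarithm is split only where \<open>q $ u\<close> is positive; at a zero
    coordinate every term carries the factor 0.\<close>
  proof (cases "q $ u = 0")
    case False
    then have "0 < q $ u" "0 < p $ u"
      using p q by (auto simp: prob_vectors_def full_support_def less_le)
    then show ?thesis
      using Z by (simp add: gibbs_def ln_div ln_mult algebra_simps)
  qed simp
  then have "KL q (gibbs p g \<delta>)
      = KL q p - \<delta> * (\<Sum>u\<in>UNIV. g $ u * q $ u) + (\<Sum>u\<in>UNIV. q $ u) * ln ?Z"
    by (simp add: KL_def sum.distrib sum_subtractf sum_distrib_left sum_distrib_right)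
  then show ?thesis
    using q by (simp add: prob_vectors_def inner_vec_def)
qed

theorem theoremD2:
  fixes p g q_star :: "real ^ 's::finite" and \<delta> :: real
  assumes "p \<in> prob_vectors"
    and "full_support p"
    and "\<not> (\<exists>c. \<forall>u. g $ u = c)"
    and "\<delta> > 0"
    and "is_arg_max (\<lambda>q. g \<bullet> q - (1 / \<delta>) * KL q p) (\<lambda>q. q \<in> prob_vectors) q_star"
  shows "\<forall>u. q_star $ u =
           p $ u * exp (\<delta> * g $ u) / (\<Sum>v\<in>UNIV. p $ v * exp (\<delta> * g $ v))"
proof -
  let ?r = "gibbs p g \<delta>"
  have r: "?r \<in> prob_vectors" "full_support ?r"
    using assms(2) by (simp_all add: gibbs_in_prob_vectors full_support_gibbs)
  have q: "q_star \<in> prob_vectors"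
    and "g \<bullet> ?r - (1 / \<delta>) * KL ?r p \<le> g \<bullet> q_star - (1 / \<delta>) * KL q_star p"
    using assms(5) r(1) by (auto simp: is_arg_max_def not_less)
  then have "\<delta> * (g \<bullet> ?r - (1 / \<delta>) * KL ?r p) \<le> \<delta> * (g \<bullet> q_star - (1 / \<delta>) * KL q_star p)"
    using assms(4) by (intro mult_left_mono) auto
  then have "\<delta> * (g \<bullet> ?r) - KL ?r p \<le> \<delta> * (g \<bullet> q_star) - KL q_star p"
    using assms(4) by (simp add: right_diff_distrib)
  \<comment> \<open>The constant \<open>ln (gibbs_sum p g \<delta>)\<close> is the same for both
    vectors and cancels, so the larger objective means the smaller divergence.\<close>
  then have "KL q_star ?r \<le> KL ?r ?r"
    using KL_gibbs[OF assms(2) q, of g \<delta>] KL_gibbs[OF assms(2) r(1), of g \<delta>] by linarith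
  also have "KL ?r ?r = 0"
    unfolding KL_def
  proof (intro sum.neutral ballI)
    show "?r $ u * ln (?r $ u / ?r $ u) = 0" for u
      by (cases "?r $ u = 0") simp_all
  qed
  finally have "q_star = ?r"
    by (rule KL_le_zero_imp_eq[OF q r])
  then show ?thesis
    by (simp add: gibbs_def gibbs_sum_def)
qed

end
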